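(* If $n\geq 1$, then the total number of inversions in all the members of $\mathcal{R}_n$ is $$\sum_{\pi\in\mathcal{R}_n}\mathrm{inv}(\pi)=\frac{B_{n+1}-(2n+7)B_n+(2n^2+4n+1)B_{n-1}-2(n-1)(n-2)B_{n-2}}{8}.$$
   Context: Permutations $\pi=\pi_1\cdots\pi_n$ of $[n]=\{1,\ldots,n\}$ are written in one-line notation. $\mathrm{inv}(\pi)$ is the number of pairs $(i,j)$ with $1\le i<j\le n$ and $\pi_i>\pi_j$. A run of $\pi$ is a maximal increasing sequence of consecutive entries. A permutation is run-sorted if $\pi_1=1$ and the first entries of its runs, read from left to right, form an increasing sequence. $\mathcal{R}_n$ denotes the set of run-sorted permutations of $[n]$. $B_n$ denotes the $n$-th Bell number, the number of set partitions of $[n]$ ($B_0=1$). For $n=1$ the last term, having coefficient $0$, is read as $0$. *)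

theory Defs
  imports Complex_Main "HOL-Library.Disjoint_Sets" "HOL-Combinatorics.Multiset_Permutations"
begin

text \<open>
  A permutation of \<open>[n]\<close> in one-line notation is a member of
  \<open>permutations_of_set {1..n}\<close>, i.e. a distinct list with set of entries \<open>{1..n}\<close>.
  Positions in lists are counted from 0, so the entry at position \<open>k\<close> of the informal
  notation is \<open>xs ! (k - 1)\<close>; the values are not shifted.
\<close>

definition inv_count :: "nat list \<Rightarrow> nat" where
  "inv_count xs = card {(i, j). i < j \<and> j < length xs \<and> xs ! i > xs ! j}"

text \<open>
  The pair \<open>(i, j)\<close> stands for the nonempty block of entries at positions \<open>i, \<dots>, j\<close>.
\<close>

definition increasing_block :: "nat list \<Rightarrow> nat \<Rightarrow> nat \<Rightarrow> bool" where
  "increasing_block xs i j \<longleftrightarrow> i \<le> j \<and> j < length xs \<and> strict_mono_on {i..j} ((!) xs)"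

definition is_run :: "nat list \<Rightarrow> nat \<Rightarrow> nat \<Rightarrow> bool" where
  "is_run xs i j \<longleftrightarrow> increasing_block xs i j \<and>
     (\<forall>i' j'. increasing_block xs i' j' \<and> {i..j} \<subseteq> {i'..j'} \<longrightarrow> {i'..j'} = {i..j})"

definition run_sorted :: "nat list \<Rightarrow> bool" where
  "run_sorted xs \<longleftrightarrow> xs \<noteq> [] \<and> xs ! 0 = 1 \<and>
     (\<forall>i j i' j'. is_run xs i j \<and> is_run xs i' j' \<and> i < i' \<longrightarrow> xs ! i < xs ! i')"

definition run_sorted_perms :: "nat \<Rightarrow> nat list set" where
  "run_sorted_perms n = {xs \<in> permutations_of_set {1..n}. run_sorted xs}"

definition bell :: "nat \<Rightarrow> nat" where
  "bell n = card {P. partition_on {1..n} P}"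

lemma bell_0: "bell 0 = 1"
  by (simp add: bell_def partition_on_empty)

end

theory Submission
  imports Defs "HOL-Computational_Algebra.Formal_Power_Series"
begin

text \<open>
  A descent in a permutation marks the border between two runs. If the permutation starts with 1,
  the first entries of its runs increase exactly when the entry after each descent is smaller than
  everything to its right (\<open>run_sorted_iff_flattened\<close>). Call such words flattened. Deleting the leading 1
  leaves an arbitrary flattened word on \<open>{2..n}\<close> and does not change the number of inversions.

  A flattened word on a set with minimum \<open>b\<close> has the form \<open>u b v\<close>, where \<open>u\<close> is the increasing
  arrangement of an arbitrary subset \<open>S\<close> of the other elements and \<open>v\<close> is an arbitrary flattened
  word on the rest (\<open>bij_betw_flattened_perms\<close>). A set partition splits in the same way, with \<open>S\<close>
  completing the block of \<open>b\<close> (\<open>bij_betw_partitions\<close>), so that there are \<open>bell m\<close> flattened words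
  on \<open>m\<close> letters. The word \<open>u b v\<close> has the inversions of \<open>v\<close>, one inversion of each letter of \<open>u\<close>
  with \<open>b\<close>, and the inversions between \<open>u\<close> and \<open>v\<close>. The number of the latter depends only on \<open>S\<close>;
  over all \<open>S\<close> of size \<open>k\<close> among \<open>m\<close> elements it averages to \<open>k (m - k) / 2\<close>
  (\<open>sum_cross_inversions\<close>).

  Hence the total number \<open>J m\<close> of inversions of flattened words on \<open>m\<close> letters satisfies
  \<open>J (m + 1) = (\<Sum>k\<le>m. (m choose k) (J (m - k) + (k + k (m - k) / 2) bell (m - k)))\<close>, a linear
  differential equation for the exponential generating function of \<open>J\<close>. It is solved in closed form
  in terms of the generating function of the Bell numbers and its first two derivatives
  (\<open>binomial_recursion_solution\<close>); the formula is the coefficient of order \<open>m = n - 1\<close>.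
\<close>

unbundle fps_syntax

section \<open>Run-sorted permutations through their descents\<close>

text \<open>
  A descent \<open>x > y\<close> marks the border between two runs, and \<open>y\<close> has to be smaller than all entries
  after it. For words starting with their minimum this is run-sortedness; as nothing is required of
  the first entry itself, the words obtained by deleting that minimum are described as well, and
  their recursion at the minimum is uniform.
\<close>

fun flattened :: "nat list \<Rightarrow> bool" where
  "flattened (x # y # zs) \<longleftrightarrow> (y < x \<longrightarrow> (\<forall>z\<in>set zs. y < z)) \<and> flattened (y # zs)"
| "flattened _ \<longleftrightarrow> True"

definition flattened_perms :: "nat set \<Rightarrow> nat list set" where
  "flattened_perms T = {w \<in> permutations_of_set T. flattened w}"

text \<open>
  The recursion is convenient for cutting words apart, the indexed form for comparison with runs.
\<close>

lemma flattened_iff_nth: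
  "flattened w \<longleftrightarrow> (\<forall>i k. Suc i < k \<and> k < length w \<and> w ! Suc i < w ! i \<longrightarrow> w ! Suc i < w ! k)"
proof (induction w rule: flattened.induct)
  case (1 x y zs)
  have "(y < x \<longrightarrow> (\<forall>z\<in>set zs. y < z)) \<longleftrightarrow>
    (\<forall>k. Suc 0 < k \<and> k < length (x # y # zs) \<and> (x # y # zs) ! Suc 0 < (x # y # zs) ! 0
        \<longrightarrow> (x # y # zs) ! Suc 0 < (x # y # zs) ! k)" (is "?L \<longleftrightarrow> ?R")
  proof
    assume ?L then show ?R
      by (auto simp: nth_Cons less_Suc_eq_0_disj split: nat.splits)
  next
    assume R: ?R
    have "y < zs ! i" if "y < x" "i < length zs" for i
      using R[rule_format, of "Suc (Suc i)"] that by simp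
    then show ?L by (auto simp: in_set_conv_nth)
  qed
  moreover have "(\<forall>i k. Suc i < k \<and> k < length (y # zs) \<and> (y # zs) ! Suc i < (y # zs) ! i
        \<longrightarrow> (y # zs) ! Suc i < (y # zs) ! k) \<longleftrightarrow>
    (\<forall>i k. Suc (Suc i) < k \<and> k < length (x # y # zs) \<and> (x # y # zs) ! Suc (Suc i) < (x # y # zs) ! Suc i
        \<longrightarrow> (x # y # zs) ! Suc (Suc i) < (x # y # zs) ! k)" (is "?L \<longleftrightarrow> ?R")
  proof
    assume L: ?L
    show ?R
    proof (intro allI impI)
      fix i k assume *: "Suc (Suc i) < k \<and> k < length (x # y # zs) \<and> (x # y # zs) ! Suc (Suc i) < (x # y # zs) ! Suc i"
      then obtain k' where "k = Suc k'" by (cases k) auto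
      with * L show "(x # y # zs) ! Suc (Suc i) < (x # y # zs) ! k" by auto
    qed
  next
    assume R: ?R
    show ?L
    proof (intro allI impI)
      fix i k assume "Suc i < k \<and> k < length (y # zs) \<and> (y # zs) ! Suc i < (y # zs) ! i"
      with R[rule_format, of i "Suc k"] show "(y # zs) ! Suc i < (y # zs) ! k" by auto
    qed
  qed
  ultimately show ?case using 1 unfolding flattened.simps
    by (metis (no_types, lifting) not0_implies_Suc)
qed auto

text \<open>
  A block of maximal length among the increasing blocks starting at \<open>i\<close> can only fail to be a run
  because it extends to the left, and that is impossible exactly when there is no ascent into \<open>i\<close>.
\<close>

lemma is_run_start_iff:
  assumes "distinct xs" and "i < length xs"
  shows "(\<exists>j. is_run xs i j) \<longleftrightarrow> i = 0 \<or> xs ! i < xs ! (i - 1)"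
proof
  assume "\<exists>j. is_run xs i j"
  then obtain j where run: "is_run xs i j" ..
  show "i = 0 \<or> xs ! i < xs ! (i - 1)"
  proof (rule ccontr)
    assume "\<not> ?thesis"
    then have "0 < i" and "xs ! (i - 1) \<le> xs ! i" by auto
    moreover have "xs ! (i - 1) \<noteq> xs ! i"
      using assms \<open>0 < i\<close> by (simp add: nth_eq_iff_index_eq)
    ultimately have lt: "xs ! (i - 1) < xs ! i" by simp
    have block: "i \<le> j" "j < length xs" "strict_mono_on {i..j} ((!) xs)"
      using run by (auto simp: is_run_def increasing_block_def)
    have "strict_mono_on {i - 1..j} ((!) xs)"
    proof (rule strict_mono_onI)
      fix r s assume rs: "r \<in> {i - 1..j}" "s \<in> {i - 1..j}" "r < s"
      then have s: "i \<le> s" by auto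
      have le: "xs ! i \<le> xs ! s"
        using strict_mono_onD[OF block(3), of i s] s rs by (cases "i = s") auto
      show "xs ! r < xs ! s"
      proof (cases "r = i - 1")
        case True then show ?thesis using lt le by simp
      next
        case False then show ?thesis using strict_mono_onD[OF block(3), of r s] rs by auto
      qed
    qed
    then have "increasing_block xs (i - 1) j"
      using block by (auto simp: increasing_block_def)
    moreover have "{i..j} \<subseteq> {i - 1..j}" by auto
    ultimately have "{i - 1..j} = {i..j}" using run unfolding is_run_def by blast
    then show False using \<open>0 < i\<close> block(1) by auto
  qed
next
  assume start: "i = 0 \<or> xs ! i < xs ! (i - 1)"
  define J where "J = {j. increasing_block xs i j}"
  have "J \<subseteq> {..<length xs}" by (auto simp: J_def increasing_block_def)
  then have fin: "finite J" by (rule finite_subset) simp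
  have "i \<in> J" using assms by (auto simp: J_def increasing_block_def strict_mono_on_def)
  then have max: "increasing_block xs i (Max J)" using Max_in[OF fin] by (auto simp: J_def)
  have "is_run xs i (Max J)" unfolding is_run_def
  proof (intro conjI allI impI)
    fix i' j' assume *: "increasing_block xs i' j' \<and> {i..Max J} \<subseteq> {i'..j'}"
    have le: "i \<le> Max J" using max by (simp add: increasing_block_def)
    with * have sub: "i' \<le> i" "Max J \<le> j'" by auto
    have mono: "strict_mono_on {i'..j'} ((!) xs)" using * by (simp add: increasing_block_def)
    have "i' = i"
    proof (rule ccontr)
      assume "i' \<noteq> i"
      then have "xs ! (i - 1) < xs ! i"
        using sub le by (intro strict_mono_onD[OF mono]) auto
      then show False using start \<open>i' \<noteq> i\<close> sub by auto
    qed
    then have "j' \<in> J" using * by (simp add: J_def)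
    then have "j' = Max J" using sub Max_ge[OF fin, of j'] by simp
    then show "{i'..j'} = {i..Max J}" using \<open>i' = i\<close> by simp
  qed (rule max)
  then show "\<exists>j. is_run xs i j" ..
qed

lemma run_sorted_iff_starts:
  assumes "distinct xs"
  shows "run_sorted xs \<longleftrightarrow> xs \<noteq> [] \<and> xs ! 0 = 1 \<and>
    (\<forall>i i'. i < i' \<and> i' < length xs \<and> (i = 0 \<or> xs ! i < xs ! (i - 1)) \<and> xs ! i' < xs ! (i' - 1)
       \<longrightarrow> xs ! i < xs ! i')"
proof -
  have "i < length xs" if "is_run xs i j" for i j
    using that by (auto simp: is_run_def increasing_block_def)
  then have start: "(\<exists>j. is_run xs i j) \<longleftrightarrow> i < length xs \<and> (i = 0 \<or> xs ! i < xs ! (i - 1))" for i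
    using is_run_start_iff[OF assms, of i] by metis
  have pair: "(\<exists>j. is_run xs i j) \<and> (\<exists>j. is_run xs i' j) \<and> i < i' \<longleftrightarrow>
    i < i' \<and> i' < length xs \<and> (i = 0 \<or> xs ! i < xs ! (i - 1)) \<and> xs ! i' < xs ! (i' - 1)" for i i'
    unfolding start by auto
  have "run_sorted xs \<longleftrightarrow> xs \<noteq> [] \<and> xs ! 0 = 1 \<and>
    (\<forall>i i'. (\<exists>j. is_run xs i j) \<and> (\<exists>j. is_run xs i' j) \<and> i < i' \<longrightarrow> xs ! i < xs ! i')"
    unfolding run_sorted_def by blast
  then show ?thesis unfolding pair .
qed

text \<open>
  If the first entries of the runs increase, an entry \<open>x\<close> that starts a run lies below all later
  entries: going right, each step is either an ascent or arrives at the start of another run.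
  Conversely, the start of a later run is one of the later entries.
\<close>

lemma run_sorted_iff_flattened:
  assumes "distinct xs" and "0 \<notin> set xs"
  shows "run_sorted xs \<longleftrightarrow> xs \<noteq> [] \<and> xs ! 0 = 1 \<and> flattened xs"
proof -
  have "flattened xs \<longleftrightarrow>
    (\<forall>i i'. i < i' \<and> i' < length xs \<and> (i = 0 \<or> xs ! i < xs ! (i - 1)) \<and> xs ! i' < xs ! (i' - 1)
       \<longrightarrow> xs ! i < xs ! i')" (is "_ \<longleftrightarrow> ?starts") if one: "xs ! 0 = 1"
  proof
    assume flat: "flattened xs"
    show ?starts
    proof (intro allI impI)
      fix i i' assume *: "i < i' \<and> i' < length xs \<and> (i = 0 \<or> xs ! i < xs ! (i - 1)) \<and> xs ! i' < xs ! (i' - 1)"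
      show "xs ! i < xs ! i'"
      proof (cases i)
        case 0
        have "xs ! i' \<noteq> xs ! 0" using * assms(1) by (subst nth_eq_iff_index_eq) auto
        moreover have "xs ! i' \<noteq> 0" using assms(2) * by (metis nth_mem)
        ultimately show ?thesis using 0 one by simp
      next
        case (Suc k)
        then show ?thesis using flat[unfolded flattened_iff_nth, rule_format, of k i'] * by auto
      qed
    qed
  next
    assume starts: ?starts
    show "flattened xs" unfolding flattened_iff_nth
    proof (intro allI impI)
      fix i k assume "Suc i < k \<and> k < length xs \<and> xs ! Suc i < xs ! i"
      then have desc: "xs ! Suc i < xs ! i" and "Suc i < k" "k < length xs" by auto
      from this(2,3) show "xs ! Suc i < xs ! k"
      proof (induction k)
        case (Suc k)
        show ?case
        proof (cases "xs ! Suc k < xs ! k")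
          case True
          then show ?thesis
            using starts[rule_format, of "Suc i" "Suc k"] desc Suc.prems by simp
        next
          case False
          moreover have "xs ! k \<noteq> xs ! Suc k"
            using Suc.prems assms(1) by (subst nth_eq_iff_index_eq) auto
          ultimately have "xs ! k < xs ! Suc k" by simp
          then show ?thesis using Suc by (cases "k = Suc i") auto
        qed
      qed simp
    qed
  qed
  then show ?thesis unfolding run_sorted_iff_starts[OF assms(1)] by blast
qed

text \<open>
  The leading 1 takes part in no inversion and in no descent, so it can be dropped.
\<close>

lemma run_sorted_perms_eq:
  assumes "n \<ge> 1"
  shows "run_sorted_perms n = (#) 1 ` flattened_perms {2..n}"
proof (rule set_eqI)
  fix xs
  have split: "{1..n} = insert 1 {2..n}" using assms by auto
  have flat_Cons: "flattened (1 # w) = flattened w" if "0 \<notin> set w" for w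
    using that by (cases w) auto
  show "xs \<in> run_sorted_perms n \<longleftrightarrow> xs \<in> (#) 1 ` flattened_perms {2..n}"
  proof
    assume "xs \<in> run_sorted_perms n"
    then have xs: "set xs = {1..n}" "distinct xs" "run_sorted xs"
      by (auto simp: run_sorted_perms_def permutations_of_set_def)
    then have "xs \<noteq> []" "xs ! 0 = 1" "flattened xs"
      using run_sorted_iff_flattened[of xs] by auto
    then obtain w where w: "xs = 1 # w" by (cases xs) auto
    have "1 \<notin> set w" "insert 1 (set w) = insert 1 {2..n}" using xs(1,2) w split by auto
    then have "set w = {2..n}" using insert_ident[of 1 "set w" "{2..n}"] by simp
    moreover have "0 \<notin> set w" using calculation by auto
    ultimately have "w \<in> flattened_perms {2..n}"
      using xs(2) w flat_Cons[of w] \<open>flattened xs\<close> by (auto simp: flattened_perms_def permutations_of_set_def)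
    then show "xs \<in> (#) 1 ` flattened_perms {2..n}" using w by blast
  next
    assume "xs \<in> (#) 1 ` flattened_perms {2..n}"
    then obtain w where w: "xs = 1 # w" "set w = {2..n}" "distinct w" "flattened w"
      by (auto simp: flattened_perms_def permutations_of_set_def)
    have xs: "set xs = {1..n}" "distinct xs" using w split by auto
    moreover have "flattened xs" using w flat_Cons[of w] by auto
    ultimately show "xs \<in> run_sorted_perms n"
      using run_sorted_iff_flattened[of xs] w
      by (auto simp: run_sorted_perms_def permutations_of_set_def)
  qed
qed

section \<open>Cutting a flattened word at its minimum\<close>

text \<open>
  A descent to the left of the minimum \<open>b\<close> would have a bottom exceeding the later entry \<open>b\<close>;
  so the left part increases. The descent into \<open>b\<close> is harmless, and the right part only has to
  be flattened itself.
\<close>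

lemma flattened_append_min:
  assumes "\<forall>x\<in>set u \<union> set v. b < x"
  shows "flattened (u @ b # v) \<longleftrightarrow> sorted u \<and> flattened v"
  using assms
proof (induction u rule: flattened.induct)
  case (1 x y zs)
  then show ?case by (auto simp: not_less) (meson Un_iff in_set_conv_decomp less_asym not_le_imp_less le_trans)+
next
  case "2_1"
  show ?case using "2_1" by (cases v) auto
next
  case ("2_2" x)
  then show ?case by (cases v) auto
qed

lemma flattened_perms_empty: "flattened_perms {} = {[]}"
  by (auto simp: flattened_perms_def)

lemma finite_flattened_perms: "finite T \<Longrightarrow> finite (flattened_perms T)"
  by (simp add: flattened_perms_def)

text \<open>
  A flattened word is determined by the set \<open>S\<close> of entries before the minimum, which is arbitrary,
  and a flattened word on the remaining entries.
\<close>

lemma bij_betw_flattened_perms: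
  assumes "finite A" and min: "\<forall>x\<in>A. b < x"
  shows "bij_betw (\<lambda>(S, v). sorted_list_of_set S @ b # v)
    (SIGMA S:Pow A. flattened_perms (A - S)) (flattened_perms (insert b A))"
    (is "bij_betw ?f ?D ?R")
proof -
  have fin: "finite S" if "S \<subseteq> A" for S using that assms(1) by (rule finite_subset)
  have into: "sorted_list_of_set S @ b # v \<in> flattened_perms (insert b A)"
    if S: "S \<subseteq> A" and v: "v \<in> flattened_perms (A - S)" for S v
  proof -
    have v': "set v = A - S" "distinct v" "flattened v"
      using v by (auto simp: flattened_perms_def permutations_of_set_def)
    have "flattened (sorted_list_of_set S @ b # v)"
      using v' S min fin[OF S] by (subst flattened_append_min) auto
    then show ?thesis
      using v' S min fin[OF S] by (auto simp: flattened_perms_def permutations_of_set_def)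
  qed
  have inj: "S = S' \<and> v = v'"
    if S: "S \<subseteq> A" "S' \<subseteq> A" and eq: "sorted_list_of_set S @ b # v = sorted_list_of_set S' @ b # v'"
    and v: "v \<in> flattened_perms (A - S)" "v' \<in> flattened_perms (A - S')" for S S' v v'
  proof -
    have "b \<notin> set (sorted_list_of_set S)" "b \<notin> set (sorted_list_of_set S')"
      "b \<notin> set v" "b \<notin> set v'"
      using S min fin[OF S(1)] fin[OF S(2)] v by (auto simp: flattened_perms_def permutations_of_set_def)
    then have "sorted_list_of_set S = sorted_list_of_set S' \<and> v = v'"
      using eq by (auto simp: append_eq_append_conv2 Cons_eq_append_conv append_eq_Cons_conv)
    then show ?thesis by (metis fin S set_sorted_list_of_set)
  qed
  have onto: "\<exists>S v. S \<subseteq> A \<and> v \<in> flattened_perms (A - S) \<and> w = sorted_list_of_set S @ b # v"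
    if w: "w \<in> flattened_perms (insert b A)" for w
  proof -
    have w': "set w = insert b A" "distinct w" "flattened w"
      using w by (auto simp: flattened_perms_def permutations_of_set_def)
    then obtain u v where uv: "w = u @ b # v" by (metis insertI1 split_list)
    have sets: "set u \<union> set v = A" "set u \<inter> set v = {}" "distinct u" "distinct v"
      using w' uv min by auto
    moreover have "sorted u" "flattened v"
      using w'(3) flattened_append_min[of u v b] sets(1) min uv by auto
    moreover have "set u \<subseteq> A" "set v = A - set u" using sets by auto
    ultimately have "v \<in> flattened_perms (A - set u)" "w = sorted_list_of_set (set u) @ b # v"
      using uv by (auto simp: flattened_perms_def permutations_of_set_def
        sorted_list_of_set.idem_if_sorted_distinct)
    then show ?thesis using \<open>set u \<subseteq> A\<close> by blast
  qed
  show ?thesis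
  proof (rule bij_betw_imageI)
    show "inj_on ?f ?D"
    proof (rule inj_onI)
      fix p q assume "p \<in> ?D" "q \<in> ?D" "?f p = ?f q"
      then show "p = q" using inj[of "fst p" "fst q" "snd p" "snd q"]
        by (auto simp: case_prod_beta)
    qed
    show "?f ` ?D = ?R"
    proof
      show "?f ` ?D \<subseteq> ?R" using into by force
      show "?R \<subseteq> ?f ` ?D"
      proof
        fix w assume "w \<in> ?R"
        then obtain S v where "(S, v) \<in> ?D" "w = ?f (S, v)" using onto by force
        then show "w \<in> ?f ` ?D" by (rule rev_image_eqI)
      qed
    qed
  qed
qed

text \<open>
  Set partitions obey the same recursion: here \<open>S\<close> is the block of \<open>a\<close> without \<open>a\<close>. Hence
  flattened words are counted by Bell numbers.
\<close>

lemma bij_betw_partitions: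
  assumes "a \<notin> A"
  shows "bij_betw (\<lambda>(S, P). insert (insert a S) P)
    (SIGMA S:Pow A. {P. partition_on (A - S) P}) {P. partition_on (insert a A) P}"
    (is "bij_betw ?f ?D ?R")
proof -
  have into: "partition_on (insert a A) (insert (insert a S) P)"
    if "S \<subseteq> A" "partition_on (A - S) P" for S P
  proof -
    have U: "\<Union>P = A - S" using that(2) by (simp add: partition_on_def)
    then have "disjnt (insert a S) (\<Union>P)" using assms by (auto simp: disjnt_iff)
    moreover have "insert a A - insert a S = A - S" using assms by auto
    ultimately show ?thesis using that by (subst partition_on_insert) auto
  qed
  have inj: "S = S' \<and> P = P'"
    if S: "S \<subseteq> A" "S' \<subseteq> A" and P: "partition_on (A - S) P" "partition_on (A - S') P'"
      and eq: "insert (insert a S) P = insert (insert a S') P'" for S S' P P'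
  proof -
    have notin: "insert a R \<notin> P" "insert a R \<notin> P'" for R
      using P[THEN partition_onD1] assms by blast+
    with eq have "insert a S = insert a S'" by (metis insertE insertI1)
    moreover have "P = P'" using eq notin calculation by (metis insert_ident)
    moreover have "a \<notin> S" "a \<notin> S'" using S assms by auto
    ultimately show ?thesis by (metis insert_ident)
  qed
  have onto: "\<exists>S P'. S \<subseteq> A \<and> partition_on (A - S) P' \<and> P = insert (insert a S) P'"
    if P: "partition_on (insert a A) P" for P
  proof -
    obtain p where p: "p \<in> P" "a \<in> p" using partition_onD1[OF P] by blast
    define S where "S = p - {a}"
    have pS: "p = insert a S" using p by (auto simp: S_def)
    have PP: "P = insert p (P - {p})" using p by auto
    have "disjnt p (\<Union>(P - {p}))"
      using partition_onD2[OF P] p by (auto simp: disjnt_def disjoint_def)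
    then have "partition_on (insert a A - p) (P - {p}) \<and> p \<subseteq> insert a A"
      using P PP partition_on_insert by metis
    moreover have "insert a A - p = A - S" using pS assms by auto
    ultimately have "S \<subseteq> A" "partition_on (A - S) (P - {p})" by (auto simp: S_def)
    then show ?thesis using PP pS by metis
  qed
  show ?thesis
  proof (rule bij_betw_imageI)
    show "inj_on ?f ?D"
    proof (rule inj_onI)
      fix p q assume "p \<in> ?D" "q \<in> ?D" "?f p = ?f q"
      then show "p = q" using inj[of "fst p" "fst q" "snd p" "snd q"]
        by (auto simp: case_prod_beta)
    qed
    show "?f ` ?D = ?R"
    proof
      show "?f ` ?D \<subseteq> ?R" using into by force
      show "?R \<subseteq> ?f ` ?D"
      proof
        fix Q assume "Q \<in> ?R"
        then obtain S P where "(S, P) \<in> ?D" "Q = ?f (S, P)" using onto by force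
        then show "Q \<in> ?f ` ?D" by (rule rev_image_eqI)
      qed
    qed
  qed
qed

section \<open>Inversions of a word cut at its minimum\<close>

lemma inv_count_Nil: "inv_count [] = 0"
  by (simp add: inv_count_def)

lemma inv_count_Cons:
  assumes "distinct xs"
  shows "inv_count (x # xs) = card {y \<in> set xs. y < x} + inv_count xs"
proof -
  let ?J = "{j. j < length xs \<and> xs ! j < x}"
  let ?I = "{(i, j). i < j \<and> j < length xs \<and> xs ! i > xs ! j}"
  have I: "finite ?I"
    by (rule finite_subset[of _ "{..<length xs} \<times> {..<length xs}"]) auto
  have "{(i, j). i < j \<and> j < length (x # xs) \<and> (x # xs) ! i > (x # xs) ! j}
      = (\<lambda>j. (0, Suc j)) ` ?J \<union> map_prod Suc Suc ` ?I" (is "?L = ?R")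
  proof (rule set_eqI)
    fix p show "p \<in> ?L \<longleftrightarrow> p \<in> ?R"
      by (cases p; cases "fst p"; cases "snd p") (auto simp: image_iff)
  qed
  moreover have "card ((\<lambda>j. (0::nat, Suc j)) ` ?J \<union> map_prod Suc Suc ` ?I)
      = card ((\<lambda>j. (0::nat, Suc j)) ` ?J) + card (map_prod Suc Suc ` ?I)"
    using I by (intro card_Un_disjoint) auto
  moreover have "card ((\<lambda>j. (0::nat, Suc j)) ` ?J) = card ?J"
    by (rule card_image) (auto simp: inj_on_def)
  moreover have "card (map_prod Suc Suc ` ?I) = card ?I"
    by (rule card_image) (auto simp: inj_on_def)
  moreover have "card ?J = card {y \<in> set xs. y < x}"
  proof -
    have "{y \<in> set xs. y < x} = (!) xs ` ?J" by (auto simp: in_set_conv_nth)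
    moreover have "inj_on ((!) xs) ?J"
      using assms by (auto simp: inj_on_def nth_eq_iff_index_eq)
    ultimately show ?thesis by (simp add: card_image)
  qed
  ultimately show ?thesis by (simp add: inv_count_def)
qed

lemma inv_count_Cons_min:
  assumes "distinct v" and "\<forall>x\<in>set v. b < x"
  shows "inv_count (b # v) = inv_count v"
proof -
  have none: "{y \<in> set v. y < b} = {}" using assms(2) by auto
  show ?thesis unfolding inv_count_Cons[OF assms(1)] none by simp
qed

lemma inv_count_sorted_append:
  assumes "sorted u" and "distinct (u @ w)"
  shows "inv_count (u @ w) = (\<Sum>x\<in>set u. card {y \<in> set w. y < x}) + inv_count w"
  using assms
proof (induction u)
  case (Cons x u)
  have "{y \<in> set (u @ w). y < x} = {y \<in> set w. y < x}" using Cons.prems by auto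
  then show ?case using Cons by (simp add: inv_count_Cons)
qed simp

definition cross_inversions :: "nat set \<Rightarrow> nat set \<Rightarrow> nat" where
  "cross_inversions S R = card {(x, y). x \<in> S \<and> y \<in> R \<and> y < x}"

lemma cross_inversions_eq_sum:
  assumes "finite S" "finite R"
  shows "cross_inversions S R = (\<Sum>x\<in>S. card {y \<in> R. y < x})"
proof -
  have "{(x, y). x \<in> S \<and> y \<in> R \<and> y < x} = (SIGMA x:S. {y \<in> R. y < x})" by auto
  then show ?thesis using assms by (simp add: cross_inversions_def card_SigmaI)
qed

text \<open>
  Each entry of \<open>S\<close> forms an inversion with the minimum \<open>b\<close>, which accounts for the summand
  \<open>card S\<close>; the other inversions lie within \<open>v\<close> or between \<open>S\<close> and \<open>v\<close>.
\<close>

lemma inv_count_flattened_split: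
  assumes "finite A" "\<forall>x\<in>A. b < x" "S \<subseteq> A" "distinct v" "set v = A - S"
  shows "inv_count (sorted_list_of_set S @ b # v)
    = inv_count v + card S + cross_inversions S (A - S)"
proof -
  have fin: "finite S" using assms by (auto intro: finite_subset)
  have less: "card {y \<in> insert b (A - S). y < x} = 1 + card {y \<in> A - S. y < x}" if "x \<in> S" for x
  proof -
    have "{y \<in> insert b (A - S). y < x} = insert b {y \<in> A - S. y < x}"
      using that assms by auto
    moreover have "b \<notin> {y \<in> A - S. y < x}" using assms by auto
    ultimately show ?thesis using assms(1) by simp
  qed
  have "distinct (sorted_list_of_set S @ b # v)" using assms fin by auto
  then have "inv_count (sorted_list_of_set S @ b # v)
    = (\<Sum>x\<in>S. card {y \<in> insert b (A - S). y < x}) + inv_count (b # v)"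
    using assms fin by (subst inv_count_sorted_append) auto
  also have "inv_count (b # v) = inv_count v"
    using assms by (intro inv_count_Cons_min) auto
  also have "(\<Sum>x\<in>S. card {y \<in> insert b (A - S). y < x}) = card S + cross_inversions S (A - S)"
    using assms(1) by (simp add: cross_inversions_eq_sum[OF fin] less sum_Suc del: insert_iff Diff_iff)
  finally show ?thesis by simp
qed

text \<open>
  Exchanging the roles of \<open>x \<in> S\<close> and \<open>y \<notin> S\<close>, that is, replacing \<open>S\<close> by \<open>S - {x} \<union> {y}\<close>, preserves
  \<open>card S\<close> and turns a pair with \<open>y < x\<close> into one with \<open>y > x\<close>. So for weights depending only on
  the size of \<open>S\<close>, on average half of the pairs in \<open>S \<times> (A - S)\<close> are inversions.
\<close>

lemma sum_cross_inversions:
  fixes f :: "nat \<Rightarrow> real"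
  assumes "finite A"
  shows "(\<Sum>S\<in>Pow A. f (card S) * cross_inversions S (A - S))
    = (\<Sum>S\<in>Pow A. f (card S) * (real (card S) * real (card A - card S) / 2))"
proof -
  let ?D = "\<lambda>S. {(x, y). x \<in> S \<and> y \<in> A - S \<and> y < x}"
  let ?U = "\<lambda>S. {(x, y). x \<in> S \<and> y \<in> A - S \<and> x < y}"
  have finS: "finite S" if "S \<in> Pow A" for S using that assms by (auto intro: finite_subset)
  have finD: "finite (?D S)" "finite (?U S)" if "S \<in> Pow A" for S
    using finS[OF that] assms by (auto intro: finite_subset[of _ "S \<times> A"])
  have swap: "(\<Sum>S\<in>Pow A. f (card S) * card (?D S)) = (\<Sum>S\<in>Pow A. f (card S) * card (?U S))"
  proof -
    have "(\<Sum>S\<in>Pow A. f (card S) * card (?D S)) = (\<Sum>S\<in>Pow A. \<Sum>p\<in>?D S. f (card S))"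
      by (simp add: mult.commute)
    also have "\<dots> = (\<Sum>(S, p)\<in>(SIGMA S:Pow A. ?D S). f (card S))"
      using assms finD by (subst sum.Sigma) auto
    also have "\<dots> = (\<Sum>(S, p)\<in>(SIGMA S:Pow A. ?U S). f (card S))"
    \<comment> \<open>The exchange of \<open>x\<close> and \<open>y\<close> is its own inverse.\<close>
    proof (rule sum.reindex_bij_witness[of _
        "\<lambda>(S, x, y). (insert y (S - {x}), y, x)" "\<lambda>(S, x, y). (insert y (S - {x}), y, x)"])
      fix t assume "t \<in> (SIGMA S:Pow A. ?D S)"
      then obtain S x y where t: "t = (S, x, y)" "S \<subseteq> A" "x \<in> S" "y \<in> A - S" "y < x" by auto
      then have "card (insert y (S - {x})) = card S"
        using finS[of S] card.remove[of S x] by simp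
      then show "(case case t of (S, x, y) \<Rightarrow> (insert y (S - {x}), y, x) of (S, p) \<Rightarrow> f (card S))
          = (case t of (S, p) \<Rightarrow> f (card S))"
        using t by simp
    qed auto
    also have "\<dots> = (\<Sum>S\<in>Pow A. \<Sum>p\<in>?U S. f (card S))"
      using assms finD by (subst sum.Sigma) auto
    finally show ?thesis by (simp add: mult.commute)
  qed
  have total: "real (card (?D S)) + real (card (?U S)) = real (card S) * real (card A - card S)"
    if "S \<in> Pow A" for S
  proof -
    have "card (?D S \<union> ?U S) = card (?D S) + card (?U S)"
      using finD[OF that] by (intro card_Un_disjoint) auto
    moreover have "?D S \<union> ?U S = S \<times> (A - S)" by auto (metis nat_neq_iff)
    moreover have "card (A - S) = card A - card S"
      using that finS[OF that] by (intro card_Diff_subset) auto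
    ultimately have "card (?D S) + card (?U S) = card S * (card A - card S)"
      by (simp add: card_cartesian_product)
    then show ?thesis by (simp only: of_nat_add[symmetric] of_nat_mult[symmetric])
  qed
  have "2 * (\<Sum>S\<in>Pow A. f (card S) * card (?D S))
      = (\<Sum>S\<in>Pow A. f (card S) * card (?D S)) + (\<Sum>S\<in>Pow A. f (card S) * card (?U S))"
    using swap by simp
  also have "\<dots> = (\<Sum>S\<in>Pow A. f (card S) * (real (card S) * real (card A - card S)))"
    unfolding sum.distrib[symmetric] distrib_left[symmetric] using total by (intro sum.cong) auto
  finally show ?thesis
    unfolding cross_inversions_def by (simp add: sum_divide_distrib[symmetric])
qed

section \<open>Recursions over the minimum of a set\<close>

lemma sum_Pow_card:
  fixes g :: "nat \<Rightarrow> real"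
  assumes "finite A"
  shows "(\<Sum>S\<in>Pow A. g (card S)) = (\<Sum>k\<le>card A. real (card A choose k) * g k)"
proof -
  have "(\<Sum>S\<in>Pow A. g (card S)) = (\<Sum>k\<le>card A. \<Sum>S | S \<in> Pow A \<and> card S = k. g (card S))"
    using assms by (intro sum.group[symmetric]) (auto intro: card_mono)
  also have "\<dots> = (\<Sum>k\<le>card A. real (card A choose k) * g k)"
    using assms by (intro sum.cong) (simp_all add: n_subsets)
  finally show ?thesis .
qed

lemma split_minimum:
  fixes T :: "nat set"
  assumes "finite T" "T \<noteq> {}"
  obtains b A where "T = insert b A" "finite A" "\<forall>x\<in>A. b < x"
proof
  have Min: "Min T \<in> T" using assms by (rule Min_in)
  then show "T = insert (Min T) (T - {Min T})" by auto
  show "finite (T - {Min T})" using assms by simp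
  show "\<forall>x\<in>T - {Min T}. Min T < x"
    using assms Min_le[of T] by (auto simp: order.strict_iff_order)
qed

text \<open>
  A set function that satisfies a recursion over the minimum, with an inhomogeneity depending only on
  cardinalities, depends only on the cardinality of its argument; grouping the subsets \<open>S\<close> by size
  then turns the recursion into a binomial convolution. This is applied with \<open>h = 0\<close> to the number
  of set partitions, and with a nonzero \<open>h\<close> to the total number of inversions.
\<close>

lemma minimum_recursion:
  fixes F :: "nat set \<Rightarrow> real"
  assumes rec: "\<And>b A. finite A \<Longrightarrow> \<forall>x\<in>A. b < x \<Longrightarrow>
    F (insert b A) = (\<Sum>S\<in>Pow A. F (A - S) + h (card A) (card S))"
  shows minimum_recursion_card: "finite T \<Longrightarrow> F T = F {1..card T}"
    and minimum_recursion_binomial: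
      "F {1..Suc m} = (\<Sum>k\<le>m. real (m choose k) * (F {1..m - k} + h m k))"
proof -
  have step: "F (insert b A) = (\<Sum>k\<le>card A. real (card A choose k) * (F {1..card A - k} + h (card A) k))"
    if A: "finite A" "\<forall>x\<in>A. b < x" and IH: "\<And>B. B \<subseteq> A \<Longrightarrow> F B = F {1..card B}" for b A
  proof -
    have "F (insert b A) = (\<Sum>S\<in>Pow A. F {1..card A - card S} + h (card A) (card S))"
      unfolding rec[OF A]
    proof (rule sum.cong[OF refl])
      fix S assume "S \<in> Pow A"
      then have "card (A - S) = card A - card S"
        using A(1) by (intro card_Diff_subset) (auto intro: finite_subset)
      then show "F (A - S) + h (card A) (card S) = F {1..card A - card S} + h (card A) (card S)"
        using IH[of "A - S"] by auto
    qed
    also have "\<dots> = (\<Sum>k\<le>card A. real (card A choose k) * (F {1..card A - k} + h (card A) k))"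
      using sum_Pow_card[OF A(1), of "\<lambda>k. F {1..card A - k} + h (card A) k"] .
    finally show ?thesis .
  qed
  have dep: "card T = n \<Longrightarrow> finite T \<Longrightarrow> F T = F {1..n}" for n T
  proof (induction n arbitrary: T rule: less_induct)
    case (less n)
    show ?case
    proof (cases n)
      case 0
      then show ?thesis using less.prems by simp
    next
      case (Suc m)
      then have ne: "T \<noteq> {}" using less.prems by auto
      then obtain b A where A: "T = insert b A" "finite A" "\<forall>x\<in>A. b < x"
        using less.prems(2) split_minimum by metis
      have "b \<notin> A" using A(3) less_irrefl by blast
      then have "card A = m" using A less.prems(1) Suc by simp
      have IH: "F B = F {1..card B}" if "B \<subseteq> C" "finite C" "card C = m" for B C
        using that less.IH[of "card B" B] Suc card_mono[of C B] by (auto intro: finite_subset)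
      have "F T = (\<Sum>k\<le>m. real (m choose k) * (F {1..m - k} + h m k))"
        using step[OF A(2,3) IH[OF _ A(2) \<open>card A = m\<close>]] unfolding A(1) \<open>card A = m\<close> .
      moreover have "F {1..n} = (\<Sum>k\<le>m. real (m choose k) * (F {1..m - k} + h m k))"
      proof -
        have split: "{1..n} = insert 1 {2..n}" and card: "card {2..n} = m" using Suc by auto
        have above: "\<forall>x\<in>{2..n}. 1 < x" by simp
        show ?thesis
          using step[OF finite_atLeastAtMost above IH[OF _ finite_atLeastAtMost card]]
          unfolding split card .
      qed
      ultimately show ?thesis by simp
    qed
  qed
  show "finite T \<Longrightarrow> F T = F {1..card T}" by (rule dep[OF refl])
  have split: "{1..Suc m} = insert 1 {2..Suc m}" and card: "card {2..Suc m} = m" by auto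
  have above: "\<forall>x\<in>{2..Suc m}. 1 < x" by simp
  have "F B = F {1..card B}" if "B \<subseteq> {2..Suc m}" for B
    using dep[OF refl] that finite_subset by blast
  from step[OF finite_atLeastAtMost above this]
  show "F {1..Suc m} = (\<Sum>k\<le>m. real (m choose k) * (F {1..m - k} + h m k))"
    unfolding split card .
qed

lemma card_partitions_insert:
  assumes "finite A" "a \<notin> A"
  shows "card {P. partition_on (insert a A) P} = (\<Sum>S\<in>Pow A. card {P. partition_on (A - S) P})"
proof -
  have "card {P. partition_on (insert a A) P} = card (SIGMA S:Pow A. {P. partition_on (A - S) P})"
    using bij_betw_same_card[OF bij_betw_partitions[OF assms(2)]] by simp
  also have "\<dots> = (\<Sum>S\<in>Pow A. card {P. partition_on (A - S) P})"
    using assms(1) by (intro card_SigmaI) (auto intro: finitely_many_partition_on)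
  finally show ?thesis .
qed

lemma card_flattened_perms_insert:
  assumes "finite A" "\<forall>x\<in>A. b < x"
  shows "card (flattened_perms (insert b A)) = (\<Sum>S\<in>Pow A. card (flattened_perms (A - S)))"
proof -
  have "card (flattened_perms (insert b A)) = card (SIGMA S:Pow A. flattened_perms (A - S))"
    using bij_betw_same_card[OF bij_betw_flattened_perms[OF assms]] by simp
  also have "\<dots> = (\<Sum>S\<in>Pow A. card (flattened_perms (A - S)))"
    using assms(1) by (intro card_SigmaI) (auto intro: finite_flattened_perms)
  finally show ?thesis .
qed

lemma partitions_recursion:
  fixes A :: "nat set"
  assumes "finite A" "\<forall>x\<in>A. b < x"
  shows "real (card {P. partition_on (insert b A) P})
    = (\<Sum>S\<in>Pow A. real (card {P. partition_on (A - S) P}) + 0)"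
proof -
  have "b \<notin> A" using assms(2) by auto
  from card_partitions_insert[OF assms(1) this] show ?thesis by simp
qed

lemma card_partitions:
  assumes "finite (A :: nat set)"
  shows "card {P. partition_on A P} = bell (card A)"
proof -
  have "real (card {P. partition_on A P}) = real (card {P. partition_on {1..card A} P})"
    by (rule minimum_recursion_card[OF partitions_recursion assms])
  then show ?thesis by (simp add: bell_def)
qed

lemma bell_Suc: "real (bell (Suc m)) = (\<Sum>k\<le>m. real (m choose k) * real (bell (m - k)))"
  using minimum_recursion_binomial[of "\<lambda>A. real (card {P. partition_on A P})" "\<lambda>_ _. 0" m,
    OF partitions_recursion] by (simp add: bell_def)

lemma card_flattened_perms:
  assumes "finite A"
  shows "card (flattened_perms A) = bell (card A)"
proof -
  have "card (flattened_perms A) = card {P. partition_on A P}"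
    using assms
  proof (induction A rule: finite_psubset_induct)
    case (psubset A)
    show ?case
    proof (cases "A = {}")
      case True
      then show ?thesis by (simp add: flattened_perms_empty partition_on_empty)
    next
      case False
      then obtain b B where A: "A = insert b B" and fin: "finite B" and min: "\<forall>x\<in>B. b < x"
        using psubset.hyps split_minimum by metis
      have "b \<notin> B" using min less_irrefl by blast
      have "B - S \<subset> A" for S using A \<open>b \<notin> B\<close> by blast
      then have IH: "card (flattened_perms (B - S)) = card {P. partition_on (B - S) P}" for S
        using psubset.IH by blast
      then show ?thesis
        using card_flattened_perms_insert[OF fin min] card_partitions_insert[OF fin \<open>b \<notin> B\<close>] A IH
        by simp
    qed
  qed
  then show ?thesis using card_partitions[OF assms] by simp
qed

definition total_inversions :: "nat set \<Rightarrow> real" where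
  "total_inversions T = (\<Sum>w\<in>flattened_perms T. real (inv_count w))"

text \<open>
  The three kinds of inversions in a word cut at its minimum are summed separately over all words:
  those in the right part give the total for a smaller set, the others are constant along the Bell
  many choices of the right part, and the ones across the cut are averaged by
  \<open>sum_cross_inversions\<close>.
\<close>

lemma total_inversions_insert:
  assumes "finite A" "\<forall>x\<in>A. b < x"
  shows "total_inversions (insert b A) = (\<Sum>S\<in>Pow A. total_inversions (A - S)
    + (real (card S) + real (card S) * real (card A - card S) / 2) * real (bell (card A - card S)))"
proof -
  let ?w = "\<lambda>(S, v). sorted_list_of_set S @ b # v"
  have fin: "finite (flattened_perms (A - S))" for S
    using assms(1) by (intro finite_flattened_perms) simp
  have cardQ: "card (flattened_perms (A - S)) = bell (card A - card S)" if "S \<in> Pow A" for S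
  proof -
    have "card (A - S) = card A - card S"
      using that assms(1) by (intro card_Diff_subset) (auto intro: finite_subset)
    then show ?thesis using card_flattened_perms[of "A - S"] assms(1) by simp
  qed
  have "total_inversions (insert b A)
      = (\<Sum>p\<in>(SIGMA S:Pow A. flattened_perms (A - S)). real (inv_count (?w p)))"
    unfolding total_inversions_def
    by (rule sum.reindex_bij_betw[OF bij_betw_flattened_perms[OF assms], symmetric])
  also have "\<dots> = (\<Sum>S\<in>Pow A. \<Sum>v\<in>flattened_perms (A - S). real (inv_count (?w (S, v))))"
    using assms(1) fin by (subst sum.Sigma) (auto simp: case_prod_beta)
  also have "\<dots> = (\<Sum>S\<in>Pow A. \<Sum>v\<in>flattened_perms (A - S).
      real (inv_count v) + (real (card S) + real (cross_inversions S (A - S))))"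
    using inv_count_flattened_split[OF assms]
    by (intro sum.cong) (auto simp: flattened_perms_def permutations_of_set_def)
  also have "\<dots> = (\<Sum>S\<in>Pow A. total_inversions (A - S)
      + (real (card S) + real (cross_inversions S (A - S))) * real (bell (card A - card S)))"
    by (intro sum.cong) (simp_all add: sum.distrib total_inversions_def cardQ algebra_simps)
  also have "\<dots> = (\<Sum>S\<in>Pow A. total_inversions (A - S) + real (card S) * real (bell (card A - card S)))
      + (\<Sum>S\<in>Pow A. real (bell (card A - card S)) * real (cross_inversions S (A - S)))"
    by (simp add: sum.distrib[symmetric] algebra_simps)
  also have "(\<Sum>S\<in>Pow A. real (bell (card A - card S)) * real (cross_inversions S (A - S)))
      = (\<Sum>S\<in>Pow A. real (bell (card A - card S)) * (real (card S) * real (card A - card S) / 2))"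
    using sum_cross_inversions[OF assms(1), of "\<lambda>k. real (bell (card A - k))"] .
  finally show ?thesis by (simp add: sum.distrib[symmetric] algebra_simps)
qed

lemma total_inversions_card:
  assumes "finite T"
  shows "total_inversions T = total_inversions {1..card T}"
  by (rule minimum_recursion_card[OF total_inversions_insert assms])

lemma total_inversions_Suc:
  "total_inversions {1..Suc m} = (\<Sum>k\<le>m. real (m choose k) * (total_inversions {1..m - k}
    + (real k + real k * real (m - k) / 2) * real (bell (m - k))))"
  by (rule minimum_recursion_binomial[OF total_inversions_insert])

section \<open>Solving the recursion with exponential generating functions\<close>

definition egf :: "(nat \<Rightarrow> real) \<Rightarrow> real fps" where
  "egf a = Abs_fps (\<lambda>n. a n / fact n)"

lemma egf_nth: "egf a $ n = a n / fact n"
  by (simp add: egf_def)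

lemma egf_deriv: "fps_deriv (egf a) = egf (\<lambda>n. a (Suc n))"
  by (simp add: fps_eq_iff egf_nth field_simps del: of_nat_Suc)

lemma egf_add: "egf (\<lambda>n. a n + b n) = egf a + egf b"
  by (simp add: fps_eq_iff egf_nth add_divide_distrib)

lemma egf_diff: "egf (\<lambda>n. a n - b n) = egf a - egf b"
  by (simp add: fps_eq_iff egf_nth diff_divide_distrib)

lemma egf_scale: "egf (\<lambda>n. c * a n) = fps_const c * egf a"
  by (simp add: fps_eq_iff egf_nth)

lemma egf_inject: "egf a = egf b \<Longrightarrow> a n = b n"
  by (simp add: fps_eq_iff egf_nth)

lemma egf_times_X: "fps_X * egf a = egf (\<lambda>n. real n * a (n - 1))"
proof (rule fps_ext)
  fix n show "(fps_X * egf a) $ n = egf (\<lambda>n. real n * a (n - 1)) $ n"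
    by (cases n) (simp_all add: egf_nth)
qed

lemma egf_mult: "egf a * egf b = egf (\<lambda>n. \<Sum>k\<le>n. real (n choose k) * (a k * b (n - k)))"
proof (rule fps_ext)
  fix n
  have "a k / fact k * (b (n - k) / fact (n - k)) = real (n choose k) * (a k * b (n - k)) / fact n"
    if "k \<le> n" for k
    using that by (simp add: binomial_fact)
  then show "(egf a * egf b) $ n = egf (\<lambda>n. \<Sum>k\<le>n. real (n choose k) * (a k * b (n - k))) $ n"
    by (simp add: fps_mult_nth egf_nth sum_divide_distrib atLeast0AtMost)
qed

text \<open>
  The difference \<open>D\<close> of two solutions satisfies \<open>D' = c D\<close>, which expresses each coefficient of \<open>D\<close>
  through earlier ones.
\<close>

lemma fps_linear_ode_unique:
  fixes F G c g :: "real fps"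
  assumes "fps_deriv F = c * F + g" "fps_deriv G = c * G + g" "F $ 0 = G $ 0"
  shows "F = G"
proof -
  define D where "D = F - G"
  have ode: "fps_deriv D = c * D" using assms by (simp add: D_def algebra_simps)
  have "D $ n = 0" for n
  proof (induction n rule: less_induct)
    case (less n)
    show ?case
    proof (cases n)
      case 0
      then show ?thesis using assms(3) by (simp add: D_def)
    next
      case (Suc m)
      have "real (Suc m) * D $ Suc m = (c * D) $ m"
        using arg_cong[OF ode, of "\<lambda>f. f $ m"] by simp
      also have "\<dots> = 0"
        unfolding fps_mult_nth using less.IH Suc by (intro sum.neutral) auto
      finally show ?thesis using Suc by simp
    qed
  qed
  then have "D = 0" by (simp add: fps_eq_iff)
  then show ?thesis by (simp add: D_def)
qed

text \<open>
  Let \<open>\<beta>\<close> and \<open>K\<close> be the exponential generating functions of \<open>B\<close> and \<open>8 J\<close>, and \<open>E = exp X\<close>.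
  The recursions read \<open>\<beta>' = E \<beta>\<close> and \<open>K' = E K + 8 X E \<beta> + 4 X\<^sup>2 E\<^sup>2 \<beta>\<close>. Substituting \<open>K = H \<beta>\<close>
  leaves \<open>H' = 8 X E + 4 X\<^sup>2 E\<^sup>2\<close>, and integration by parts with \<open>H(0) = 0\<close> yields
  \<open>H = (1 - 2 X + 2 X\<^sup>2) E\<^sup>2 + (8 X - 8) E + 7\<close>. Since \<open>E \<beta> = \<beta>'\<close> and \<open>E\<^sup>2 \<beta> = \<beta>'' - \<beta>'\<close>, the product
  \<open>H \<beta>\<close> is a combination of \<open>\<beta>, \<beta>', \<beta>''\<close> with polynomial coefficients, and comparing coefficients
  gives \<open>8 J\<close> in terms of \<open>B\<close> at four consecutive arguments.
\<close>

lemma binomial_recursion_solution: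
  fixes B J :: "nat \<Rightarrow> real"
  assumes B: "\<And>m. B (Suc m) = (\<Sum>k\<le>m. real (m choose k) * B (m - k))"
    and J0: "J 0 = 0"
    and J: "\<And>m. J (Suc m) = (\<Sum>k\<le>m. real (m choose k) * (J (m - k)
      + (real k + real k * real (m - k) / 2) * B (m - k)))"
  shows "8 * J m = B (m + 2) - (2 * real m + 9) * B (m + 1)
    + (2 * (real m)^2 + 8 * real m + 7) * B m - 2 * real m * (real m - 1) * B (m - 1)"
proof -
  define E where "E = egf (\<lambda>_. 1)"
  define \<beta> where "\<beta> = egf B"
  define K where "K = egf (\<lambda>m. 8 * J m)"
  have dE: "fps_deriv E = E" by (simp add: E_def egf_deriv)
  have d\<beta>: "fps_deriv \<beta> = E * \<beta>"
    by (simp add: \<beta>_def E_def egf_deriv egf_mult B)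
  have XE: "fps_X * E = egf real" by (simp add: E_def egf_times_X)
  have Xd\<beta>: "fps_X * fps_deriv \<beta> = egf (\<lambda>n. real n * B n)"
  proof -
    have "real n * B (Suc (n - 1)) = real n * B n" for n by (cases n) auto
    then show ?thesis unfolding \<beta>_def egf_deriv egf_times_X by (simp only:)
  qed
  have dK: "fps_deriv K = E * K + (8 * (fps_X * E) * \<beta> + 4 * (fps_X * E) * (fps_X * (E * \<beta>)))"
  proof -
    have "fps_deriv K = egf (\<lambda>n. (\<Sum>k\<le>n. real (n choose k) * (1 * (8 * J (n - k))))
        + (8 * (\<Sum>k\<le>n. real (n choose k) * (real k * B (n - k)))
        + 4 * (\<Sum>k\<le>n. real (n choose k) * (real k * (real (n - k) * B (n - k))))))"
      unfolding K_def egf_deriv J sum_distrib_left sum.distrib[symmetric]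
      by (intro arg_cong[of _ _ egf] ext sum.cong refl) (simp add: field_simps)
    also have "\<dots> = E * K + (8 * (egf real * \<beta>) + 4 * (egf real * (fps_X * fps_deriv \<beta>)))"
      unfolding egf_add egf_scale numeral_fps_const Xd\<beta>
      unfolding E_def K_def \<beta>_def egf_mult ..
    finally show ?thesis by (simp add: XE d\<beta> mult.assoc)
  qed
  \<comment> \<open>The product \<open>H \<beta>\<close>, with the terms in \<open>E\<^sup>2\<close> completed to \<open>\<beta>'' = E \<beta> + E\<^sup>2 \<beta>\<close>.\<close>
  let ?S = "(1 - 2 * fps_X + 2 * fps_X * fps_X) * (E * \<beta> + E * E * \<beta>)
    + (- 9 + 10 * fps_X - 2 * fps_X * fps_X) * (E * \<beta>) + 7 * \<beta>"
  have "K = ?S"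
  proof (rule fps_linear_ode_unique[OF dK])
    show "fps_deriv ?S = E * ?S + (8 * (fps_X * E) * \<beta> + 4 * (fps_X * E) * (fps_X * (E * \<beta>)))"
      by (simp add: dE d\<beta> algebra_simps)
    show "K $ 0 = ?S $ 0"
      by (simp add: K_def egf_nth J0 fps_mult_nth E_def \<beta>_def)
  qed
  also have "?S = fps_deriv (fps_deriv \<beta>) - 2 * (fps_X * fps_deriv (fps_deriv \<beta>))
      + 2 * (fps_X * (fps_X * fps_deriv (fps_deriv \<beta>))) - 9 * fps_deriv \<beta>
      + 10 * (fps_X * fps_deriv \<beta>) - 2 * (fps_X * (fps_X * fps_deriv \<beta>)) + 7 * \<beta>"
    by (simp add: dE d\<beta> algebra_simps)
  also have "\<dots> = egf (\<lambda>n. B (Suc (Suc n)) - 2 * (real n * B (Suc (Suc (n - 1))))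
      + 2 * (real n * (real (n - 1) * B (Suc (Suc (n - 1 - 1))))) - 9 * B (Suc n)
      + 10 * (real n * B (Suc (n - 1))) - 2 * (real n * (real (n - 1) * B (Suc (n - 1 - 1)))) + 7 * B n)"
    unfolding \<beta>_def egf_deriv egf_times_X numeral_fps_const egf_scale[symmetric]
      egf_add[symmetric] egf_diff[symmetric] ..
  finally have "8 * J m = B (Suc (Suc m)) - 2 * (real m * B (Suc (Suc (m - 1))))
      + 2 * (real m * (real (m - 1) * B (Suc (Suc (m - 1 - 1))))) - 9 * B (Suc m)
      + 10 * (real m * B (Suc (m - 1))) - 2 * (real m * (real (m - 1) * B (Suc (m - 1 - 1)))) + 7 * B m"
    unfolding K_def by (rule egf_inject)
  \<comment> \<open>Terms in which the truncated subtraction matters carry a vanishing factor.\<close>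
  then show ?thesis
    by (cases m; cases "m - 1") (simp_all add: algebra_simps power2_eq_square)
qed

theorem theorem2p5:
  fixes n :: nat
  assumes "n \<ge> 1"
  shows "real (\<Sum>xs\<in>run_sorted_perms n. inv_count xs) =
    (real (bell (n + 1)) - (2 * real n + 7) * real (bell n)
      + (2 * (real n)^2 + 4 * real n + 1) * real (bell (n - 1))
      - 2 * (real n - 1) * (real n - 2) * real (bell (n - 2))) / 8"
proof -
  have inv: "inv_count (1 # w) = inv_count w" if "w \<in> flattened_perms {2..n}" for w
    using that by (intro inv_count_Cons_min) (auto simp: flattened_perms_def permutations_of_set_def)
  have "real (\<Sum>xs\<in>run_sorted_perms n. inv_count xs)
      = (\<Sum>w\<in>flattened_perms {2..n}. real (inv_count (1 # w)))"
    unfolding run_sorted_perms_eq[OF assms] by (subst sum.reindex) simp_all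
  also have "\<dots> = total_inversions {2..n}"
    unfolding total_inversions_def by (intro sum.cong) (simp_all only: inv)
  also have "\<dots> = total_inversions {1..n - 1}"
    using total_inversions_card[of "{2..n}"] by simp
  finally have total: "real (\<Sum>xs\<in>run_sorted_perms n. inv_count xs) = total_inversions {1..n - 1}" .
  have empty: "total_inversions {1..0} = 0"
    by (simp add: total_inversions_def flattened_perms_empty inv_count_Nil)
  have "8 * total_inversions {1..n - 1} = real (bell (n - 1 + 2))
      - (2 * real (n - 1) + 9) * real (bell (n - 1 + 1))
      + (2 * (real (n - 1))^2 + 8 * real (n - 1) + 7) * real (bell (n - 1))
      - 2 * real (n - 1) * (real (n - 1) - 1) * real (bell (n - 1 - 1))"
    by (rule binomial_recursion_solution[of "\<lambda>m. real (bell m)" "\<lambda>m. total_inversions {1..m}",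
        OF bell_Suc empty total_inversions_Suc])
  moreover have "n - 1 + 2 = n + 1" "n - 1 + 1 = n" "n - 1 - 1 = n - 2" "real (n - 1) = real n - 1"
    using assms by auto
  ultimately show ?thesis
    unfolding total by (simp add: algebra_simps power2_eq_square)
qed

end
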